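(* Let $G$ be the group with generators $a,b,c,d$ and the three defining relations $$d^{-1}\,b^{-d}\,c^{-2d^{-1}}\,b^{-d}\,c^{-2d^{-1}}\,a\,a^{-2d}\,d=a^{-1}\,b^{-d}\,c^{-2d^{-1}}\,a,$$ $$c^{-1}bc=b^{-d}\,c^{d^{-1}}\,b^{d},$$ $$c=b^{-d}\,c^{-2d^{-1}}\,b^{-d}\,c^{-2d^{-1}}\,a\,a^{-d}\,a^{-1}\,c^{2d^{-1}}\,b^{2d}.$$ Then $G$ is not isomorphic to the free group of rank 2.
   Context: Exponent notation: $g^{h}=h^{-1}gh$, and for an integer $k$, $g^{kh}=h^{-1}g^{k}h$; thus $b^{-d}=d^{-1}b^{-1}d$, $a^{-2d}=d^{-1}a^{-2}d$, $c^{-2d^{-1}}=dc^{-2}d^{-1}$, $c^{d^{-1}}=dcd^{-1}$, $b^{2d}=d^{-1}b^2d$. (The group $G$ is the group $G_3(Ki)$ of the Kishino knot $Ki$; the corresponding group $G_3(U)$ of the trivial knot $U$ is the free group of rank 2.) *)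

theory Defs
  imports "HOL-Algebra.Coset"
begin

section \<open>Free groups\<close>

text \<open>The letter \<open>(x, True)\<close> is the generator \<open>x\<close> and \<open>(x, False)\<close> is its formal inverse.
  The elements of the free group are the reduced words in these letters.\<close>

type_synonym 'x word = "('x \<times> bool) list"

definition inv_letter :: "'x \<times> bool \<Rightarrow> 'x \<times> bool" where
  "inv_letter l = (fst l, \<not> snd l)"

definition reduced :: "'x word \<Rightarrow> bool" where
  "reduced = successively (\<lambda>l m. m \<noteq> inv_letter l)"

fun cons_reduce :: "'x \<times> bool \<Rightarrow> 'x word \<Rightarrow> 'x word" where
  "cons_reduce l [] = [l]"
| "cons_reduce l (m # w) = (if m = inv_letter l then w else l # m # w)"

definition reduce :: "'x word \<Rightarrow> 'x word" where
  "reduce w = foldr cons_reduce w []"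

definition free_group :: "'x set \<Rightarrow> 'x word monoid" where
  "free_group X =
     \<lparr>carrier = {w \<in> lists (X \<times> UNIV). reduced w},
      mult = (\<lambda>u v. reduce (u @ v)),
      one = []\<rparr>"

definition free_gen :: "'x \<Rightarrow> 'x word" where
  "free_gen x = [(x, True)]"


section \<open>Presentations\<close>

definition normal_closure :: "('g, 'm) monoid_scheme \<Rightarrow> 'g set \<Rightarrow> 'g set" where
  "normal_closure G S = carrier G \<inter> \<Inter>{N. N \<lhd> G \<and> S \<subseteq> N}"

text \<open>A relation \<open>l = r\<close> between elements of the free group is represented by the pair \<open>(l, r)\<close>.\<close>

definition presented_group :: "'x set \<Rightarrow> ('x word \<times> 'x word) set \<Rightarrow> 'x word set monoid" where
  "presented_group X R =
     free_group X Mod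
       normal_closure (free_group X)
         ((\<lambda>(l, r). l \<otimes>\<^bsub>free_group X\<^esub> inv\<^bsub>free_group X\<^esub> r) ` R)"


section \<open>The group of the Kishino knot\<close>

text \<open>The exponent notation: \<open>conj_pow G g k h\<close> is \<open>g\<close> to the exponent \<open>kh\<close>,
  i.e. the conjugate of the \<open>k\<close>-th power of \<open>g\<close> by \<open>h\<close>, with the inverse of \<open>h\<close> on the left.\<close>

definition conj_pow :: "('g, 'm) monoid_scheme \<Rightarrow> 'g \<Rightarrow> int \<Rightarrow> 'g \<Rightarrow> 'g" where
  "conj_pow G g k h = inv\<^bsub>G\<^esub> h \<otimes>\<^bsub>G\<^esub> (g [^]\<^bsub>G\<^esub> k) \<otimes>\<^bsub>G\<^esub> h"

definition kishino_relations :: "('g, 'm) monoid_scheme \<Rightarrow> 'g \<Rightarrow> 'g \<Rightarrow> 'g \<Rightarrow> 'g \<Rightarrow> ('g \<times> 'g) set" where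
  "kishino_relations G a b c d =
     {(inv\<^bsub>G\<^esub> d \<otimes>\<^bsub>G\<^esub> conj_pow G b (-1) d \<otimes>\<^bsub>G\<^esub> conj_pow G c (-2) (inv\<^bsub>G\<^esub> d)
         \<otimes>\<^bsub>G\<^esub> conj_pow G b (-1) d \<otimes>\<^bsub>G\<^esub> conj_pow G c (-2) (inv\<^bsub>G\<^esub> d)
         \<otimes>\<^bsub>G\<^esub> a \<otimes>\<^bsub>G\<^esub> conj_pow G a (-2) d \<otimes>\<^bsub>G\<^esub> d,
       inv\<^bsub>G\<^esub> a \<otimes>\<^bsub>G\<^esub> conj_pow G b (-1) d \<otimes>\<^bsub>G\<^esub> conj_pow G c (-2) (inv\<^bsub>G\<^esub> d) \<otimes>\<^bsub>G\<^esub> a),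
      (inv\<^bsub>G\<^esub> c \<otimes>\<^bsub>G\<^esub> b \<otimes>\<^bsub>G\<^esub> c,
       conj_pow G b (-1) d \<otimes>\<^bsub>G\<^esub> conj_pow G c 1 (inv\<^bsub>G\<^esub> d) \<otimes>\<^bsub>G\<^esub> conj_pow G b 1 d),
      (c,
       conj_pow G b (-1) d \<otimes>\<^bsub>G\<^esub> conj_pow G c (-2) (inv\<^bsub>G\<^esub> d)
         \<otimes>\<^bsub>G\<^esub> conj_pow G b (-1) d \<otimes>\<^bsub>G\<^esub> conj_pow G c (-2) (inv\<^bsub>G\<^esub> d)
         \<otimes>\<^bsub>G\<^esub> a \<otimes>\<^bsub>G\<^esub> conj_pow G a (-1) d \<otimes>\<^bsub>G\<^esub> inv\<^bsub>G\<^esub> a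
         \<otimes>\<^bsub>G\<^esub> conj_pow G c 2 (inv\<^bsub>G\<^esub> d) \<otimes>\<^bsub>G\<^esub> conj_pow G b 2 d)}"

datatype kishino_gen = Gen_a | Gen_b | Gen_c | Gen_d

definition kishino_group :: "kishino_gen word set monoid" where
  "kishino_group =
     presented_group UNIV
       (kishino_relations (free_group UNIV)
          (free_gen Gen_a) (free_gen Gen_b) (free_gen Gen_c) (free_gen Gen_d))"


section \<open>Basic properties\<close>

lemma inv_letter_inv_letter [simp]: "inv_letter (inv_letter l) = l"
  by (simp add: inv_letter_def)

lemma inv_letter_neq [simp]: "inv_letter l \<noteq> l" "l \<noteq> inv_letter l"
  by (simp_all add: inv_letter_def prod_eq_iff)

lemma reduced_Nil [simp]: "reduced []"
  by (simp add: reduced_def)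

lemma reduced_Cons:
  "reduced (l # w) \<longleftrightarrow> reduced w \<and> (w = [] \<or> hd w \<noteq> inv_letter l)"
  by (cases w) (auto simp: reduced_def)

lemma reduced_cons_reduce: "reduced w \<Longrightarrow> reduced (cons_reduce l w)"
  by (cases w) (auto simp: reduced_Cons)

lemma reduced_foldr: "reduced v \<Longrightarrow> reduced (foldr cons_reduce u v)"
  by (induction u) (auto intro: reduced_cons_reduce)

lemma reduced_reduce: "reduced (reduce w)"
  by (simp add: reduce_def reduced_foldr)

lemma cons_reduce_reduced: "reduced (l # w) \<Longrightarrow> cons_reduce l w = l # w"
  by (cases w) (auto simp: reduced_Cons)

lemma reduce_reduced: "reduced w \<Longrightarrow> reduce w = w"
  by (induction w) (auto simp: reduce_def reduced_Cons cons_reduce_reduced)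

lemma reduce_append: "reduced v \<Longrightarrow> reduce (u @ v) = foldr cons_reduce u v"
  using reduce_reduced[of v] by (simp add: reduce_def)

lemma cons_reduce_cancel:
  "reduced w \<Longrightarrow> cons_reduce l (cons_reduce (inv_letter l) w) = w"
  by (cases w) (auto simp: reduced_Cons cons_reduce_reduced)

lemma foldr_cons_reduce:
  assumes "reduced w"
  shows "foldr cons_reduce (cons_reduce l u) w = cons_reduce l (foldr cons_reduce u w)"
proof (cases u)
  case (Cons m u')
  have "reduced (foldr cons_reduce u' w)"
    using assms by (rule reduced_foldr)
  then show ?thesis
    using Cons by (simp add: cons_reduce_cancel)
qed simp

lemma foldr_foldr_cons_reduce:
  assumes "reduced w"
  shows "foldr cons_reduce (foldr cons_reduce u v) w = foldr cons_reduce u (foldr cons_reduce v w)"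
  by (induction u) (simp_all add: foldr_cons_reduce assms)

lemma set_cons_reduce: "set (cons_reduce l w) \<subseteq> insert l (set w)"
  by (cases w) auto

lemma set_foldr_cons_reduce: "set (foldr cons_reduce u v) \<subseteq> set u \<union> set v"
proof (induction u)
  case (Cons l u)
  then show ?case
    using set_cons_reduce[of l "foldr cons_reduce u v"] by auto
qed simp

lemma carrier_free_group:
  "w \<in> carrier (free_group X) \<longleftrightarrow> w \<in> lists (X \<times> UNIV) \<and> reduced w"
  by (simp add: free_group_def)

lemma one_free_group: "\<one>\<^bsub>free_group X\<^esub> = []"
  by (simp add: free_group_def)

lemma one_closed_free_group: "\<one>\<^bsub>free_group X\<^esub> \<in> carrier (free_group X)"
  by (simp add: carrier_free_group one_free_group)

lemma mult_free_group:
  "reduced v \<Longrightarrow> u \<otimes>\<^bsub>free_group X\<^esub> v = foldr cons_reduce u v"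
  by (simp add: free_group_def reduce_append)

lemma mult_closed_free_group:
  assumes "u \<in> carrier (free_group X)" "v \<in> carrier (free_group X)"
  shows "u \<otimes>\<^bsub>free_group X\<^esub> v \<in> carrier (free_group X)"
  using assms set_foldr_cons_reduce[of u v]
  by (auto simp: carrier_free_group mult_free_group reduced_foldr in_lists_conv_set)

lemma foldr_cons_reduce_left_inverse:
  assumes "reduced w"
  shows "foldr cons_reduce (rev (map inv_letter u)) (foldr cons_reduce u w) = w"
proof (induction u)
  case (Cons l u)
  have "cons_reduce (inv_letter l) (cons_reduce (inv_letter (inv_letter l)) (foldr cons_reduce u w))
      = foldr cons_reduce u w"
    using assms by (intro cons_reduce_cancel reduced_foldr)
  then show ?case using Cons by simp
qed (use assms in simp)

theorem group_free_group: "group (free_group X)"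
proof (rule groupI)
  fix u v w
  assume u: "u \<in> carrier (free_group X)" and v: "v \<in> carrier (free_group X)"
    and w: "w \<in> carrier (free_group X)"
  show "u \<otimes>\<^bsub>free_group X\<^esub> v \<otimes>\<^bsub>free_group X\<^esub> w = u \<otimes>\<^bsub>free_group X\<^esub> (v \<otimes>\<^bsub>free_group X\<^esub> w)"
    using u v w
    by (simp add: carrier_free_group mult_free_group reduced_foldr foldr_foldr_cons_reduce)
next
  fix u assume u: "u \<in> carrier (free_group X)"
  define v where "v = reduce (rev (map inv_letter u))"
  have "set v \<subseteq> set (rev (map inv_letter u))"
    using set_foldr_cons_reduce[of "rev (map inv_letter u)" "[]"] by (simp add: v_def reduce_def)
  moreover have "set (rev (map inv_letter u)) \<subseteq> X \<times> UNIV"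
    using u by (auto simp: carrier_free_group inv_letter_def in_lists_conv_set)
  ultimately have "v \<in> carrier (free_group X)"
    by (auto simp: carrier_free_group v_def reduced_reduce in_lists_conv_set)
  moreover have "v \<otimes>\<^bsub>free_group X\<^esub> u = \<one>\<^bsub>free_group X\<^esub>"
  proof -
    have ru: "reduced u" using u by (simp add: carrier_free_group)
    have "v \<otimes>\<^bsub>free_group X\<^esub> u = foldr cons_reduce (rev (map inv_letter u)) u"
      by (simp add: mult_free_group ru v_def reduce_def foldr_foldr_cons_reduce)
    also have "\<dots> = foldr cons_reduce (rev (map inv_letter u)) (foldr cons_reduce u [])"
      using reduce_reduced[OF ru] by (simp add: reduce_def)
    also have "\<dots> = []"
      by (rule foldr_cons_reduce_left_inverse) simp
    finally show ?thesis by (simp add: one_free_group)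
  qed
  ultimately show "\<exists>v\<in>carrier (free_group X). v \<otimes>\<^bsub>free_group X\<^esub> u = \<one>\<^bsub>free_group X\<^esub>"
    by blast
next
  fix u assume "u \<in> carrier (free_group X)"
  then show "\<one>\<^bsub>free_group X\<^esub> \<otimes>\<^bsub>free_group X\<^esub> u = u"
    by (simp add: carrier_free_group one_free_group mult_free_group)
qed (simp_all add: mult_closed_free_group one_closed_free_group)

lemma free_gen_closed: "x \<in> X \<Longrightarrow> free_gen x \<in> carrier (free_group X)"
  by (simp add: free_gen_def carrier_free_group reduced_Cons)

theorem free_group_universal:
  assumes "group H" and f: "\<And>x. x \<in> X \<Longrightarrow> f x \<in> carrier H"
  shows "\<exists>h. h \<in> hom (free_group X) H \<and> (\<forall>x\<in>X. h (free_gen x) = f x)"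
proof -
  interpret H: group H by fact
  define val where "val = (\<lambda>l. if snd l then f (fst l) else inv\<^bsub>H\<^esub> f (fst l))"
  define h where "h = (\<lambda>w. foldr (\<lambda>l y. val l \<otimes>\<^bsub>H\<^esub> y) w \<one>\<^bsub>H\<^esub>)"
  have h_simps [simp]: "h [] = \<one>\<^bsub>H\<^esub>" "h (l # w) = val l \<otimes>\<^bsub>H\<^esub> h w" for l w
    by (simp_all add: h_def)
  have val_closed: "val l \<in> carrier H" if "l \<in> X \<times> UNIV" for l
    using that f by (auto simp: val_def)
  have h_closed: "h w \<in> carrier H" if "w \<in> lists (X \<times> UNIV)" for w
    using that by induction (auto intro!: val_closed)
  have val_inv: "val l \<otimes>\<^bsub>H\<^esub> (val (inv_letter l) \<otimes>\<^bsub>H\<^esub> y) = y"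
    if "l \<in> X \<times> UNIV" "y \<in> carrier H" for l y
    using that f by (auto simp: val_def inv_letter_def simp flip: H.m_assoc)
  have h_cons: "h (cons_reduce l w) = val l \<otimes>\<^bsub>H\<^esub> h w"
    if "l \<in> X \<times> UNIV" "w \<in> lists (X \<times> UNIV)" for l w
  proof (cases w)
    case (Cons m w')
    then show ?thesis using that val_inv h_closed by auto
  qed simp
  have lists: "foldr cons_reduce u v \<in> lists (X \<times> UNIV)"
    if "u \<in> lists (X \<times> UNIV)" "v \<in> lists (X \<times> UNIV)" for u v
    using that set_foldr_cons_reduce[of u v] by (auto simp: in_lists_conv_set)
  have h_mult: "h (foldr cons_reduce u v) = h u \<otimes>\<^bsub>H\<^esub> h v"
    if "u \<in> lists (X \<times> UNIV)" "v \<in> lists (X \<times> UNIV)" for u v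
    using that
  proof (induction u)
    case (Cons l u)
    have "h (foldr cons_reduce (l # u) v) = val l \<otimes>\<^bsub>H\<^esub> (h u \<otimes>\<^bsub>H\<^esub> h v)"
      using Cons h_cons[OF Cons.hyps(1) lists] by simp
    then show ?case
      using Cons.hyps Cons.prems val_closed h_closed by (simp add: H.m_assoc)
  qed (simp add: h_closed)
  have "h \<in> hom (free_group X) H"
    by (rule homI) (auto simp: carrier_free_group mult_free_group h_mult h_closed)
  moreover have "\<forall>x\<in>X. h (free_gen x) = f x"
    using f by (auto simp: free_gen_def val_def)
  ultimately show ?thesis by blast
qed

theorem normal_normal_closure:
  assumes "group G"
  shows "normal_closure G S \<lhd> G"
proof -
  interpret group G by fact
  have "subgroup (normal_closure G S) G"
    by (rule subgroupI)
      (auto simp: normal_closure_def normal_def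
        intro: subgroup.one_closed subgroup.m_closed subgroup.m_inv_closed)
  then show ?thesis
    by (auto simp: normal_inv_iff normal_closure_def)
qed

corollary group_presented_group: "group (presented_group X R)"
  unfolding presented_group_def
  by (intro normal.factorgroup_is_group normal_normal_closure group_free_group)

corollary group_kishino_group: "group kishino_group"
  unfolding kishino_group_def by (rule group_presented_group)

end

theory Submission
  imports Defs "HOL-Library.Numeral_Type"
begin

text \<open>The group of the Kishino knot cannot be generated by two elements. A group with two generators
  \<open>x, y\<close> has, for every character \<open>\<chi>\<close> with values in the multiplicative group of a field \<open>F\<close>, at
  most a two-dimensional space of crossed homomorphisms into \<open>F\<close>, since such a map is determined by its
  values at \<open>x\<close> and \<open>y\<close>. For the character \<open>(a, b, c, d) \<mapsto> (2, 2, 2, 1)\<close> into the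
  units of the field with five elements, the Fox derivatives of the three relations reduce to the single equation
  \<open>t d = t c - t a\<close>, so that the space is three-dimensional.

  All crossed homomorphisms \<open>t\<close> are handled at once, by one homomorphism into the semidirect
  product of the units with the functions of the parameter \<open>(t a, t b, t c)\<close>.\<close>

definition affine_group :: "('r::comm_ring_1 \<times> ('v \<Rightarrow> 'r)) monoid" where
  "affine_group =
     \<lparr>carrier = {(u, f). u dvd 1},
      mult = (\<lambda>(u, f) (w, g). (u * w, \<lambda>v. f v + u * g v)),
      one = (1, \<lambda>_. 0)\<rparr>"

lemma affine_group_simps [simp]:
  "(u, f) \<in> carrier affine_group \<longleftrightarrow> u dvd 1"
  "(u, f) \<otimes>\<^bsub>affine_group\<^esub> (w, g) = (u * w, \<lambda>v. f v + u * g v)"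
  "\<one>\<^bsub>affine_group\<^esub> = (1, \<lambda>_. 0)"
  by (simp_all add: affine_group_def)

lemma is_unit_mult: "u dvd 1 \<Longrightarrow> w dvd 1 \<Longrightarrow> u * w dvd 1" for u w :: "'r::comm_ring_1"
  using mult_dvd_mono[of u 1 w 1] by simp

lemma group_affine_group: "group (affine_group :: ('r::comm_ring_1 \<times> ('v \<Rightarrow> 'r)) monoid)"
proof (rule groupI)
  fix x :: "'r \<times> ('v \<Rightarrow> 'r)"
  assume x: "x \<in> carrier affine_group"
  obtain u f where uf: "x = (u, f)" by fastforce
  then obtain w where w: "1 = u * w" using x by auto
  have "(w, \<lambda>v. - w * f v) \<in> carrier affine_group"
    using w by (simp add: dvd_def) (metis mult.commute)
  moreover have "(w, \<lambda>v. - w * f v) \<otimes>\<^bsub>affine_group\<^esub> x = \<one>\<^bsub>affine_group\<^esub>"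
    using w uf by (simp add: mult.commute)
  ultimately show "\<exists>y\<in>carrier affine_group. y \<otimes>\<^bsub>affine_group\<^esub> x = \<one>\<^bsub>affine_group\<^esub>"
    by blast
qed (auto simp: algebra_simps fun_eq_iff is_unit_mult)

lemma inv_affine_group:
  assumes "u * w = 1"
  shows "inv\<^bsub>affine_group\<^esub> (u, f) = (w, \<lambda>v. - w * f v)"
proof -
  interpret group "affine_group :: ('a \<times> ('b \<Rightarrow> 'a)) monoid"
    by (rule group_affine_group)
  have "u dvd 1" "w dvd 1"
    using assms by (auto simp: dvd_def) (metis mult.commute)+
  then show ?thesis
    using assms by (intro inv_equality) (simp_all add: mult.commute)
qed

text \<open>Evaluation at \<open>v\<close> and at \<open>v'\<close> gives two homomorphisms to the
  affine maps \<open>x \<mapsto> u * x + f v\<close> of the ring, and this set is where they agree.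
  Membership of generators is how crossed homomorphisms with two different parameters get
  compared.\<close>

lemma subgroup_affine_group_eq:
  "subgroup {x \<in> carrier affine_group. snd x v = snd x v'}
     (affine_group :: ('r::comm_ring_1 \<times> ('v \<Rightarrow> 'r)) monoid)"
proof -
  interpret group "affine_group :: ('r \<times> ('v \<Rightarrow> 'r)) monoid"
    by (rule group_affine_group)
  show ?thesis
  proof (rule subgroupI)
    fix x :: "'r \<times> ('v \<Rightarrow> 'r)"
    assume x: "x \<in> {x \<in> carrier affine_group. snd x v = snd x v'}"
    obtain u f where uf: "x = (u, f)" by fastforce
    then obtain w where "u * w = 1" using x by (auto simp: dvd_def)
    then have "inv\<^bsub>affine_group\<^esub> x = (w, \<lambda>v. - w * f v)"
      by (simp add: uf inv_affine_group)
    then show "inv\<^bsub>affine_group\<^esub> x \<in> {x \<in> carrier affine_group. snd x v = snd x v'}"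
      using x uf inv_closed[of x] by auto
  next
    have "\<one>\<^bsub>affine_group\<^esub> \<in> {x \<in> carrier affine_group. snd x v = snd x v'}" by simp
    then show "{x \<in> carrier (affine_group :: ('r \<times> ('v \<Rightarrow> 'r)) monoid). snd x v = snd x v'} \<noteq> {}"
      by blast
  qed (auto simp: is_unit_mult)
qed

text \<open>Free generators generate: in a reduced word the first letter splits off as a factor
  without cancellation, and a letter is a generator or the inverse of one.\<close>

lemma hom_free_group_in_subgroup:
  assumes "group H" and h: "h \<in> hom (free_group X) H" and K: "subgroup K H"
    and gen: "\<And>x. x \<in> X \<Longrightarrow> h (free_gen x) \<in> K"
    and w: "w \<in> carrier (free_group X)"
  shows "h w \<in> K"
proof -
  interpret group_hom "free_group X" H h
    by (intro group_hom.intro group_hom_axioms.intro group_free_group assms)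
  show ?thesis
    using w
  proof (induction w)
    case Nil
    then show ?case
      using hom_one subgroup.one_closed[OF K] by (simp add: one_free_group)
  next
    case (Cons l w)
    then have red: "reduced w" and w: "w \<in> carrier (free_group X)" and l: "fst l \<in> X"
      and l': "[l] \<in> carrier (free_group X)"
      by (auto simp: carrier_free_group reduced_Cons)
    have "l # w = [l] \<otimes>\<^bsub>free_group X\<^esub> w"
      using Cons.prems red by (simp add: carrier_free_group mult_free_group cons_reduce_reduced)
    then have split: "h (l # w) = h [l] \<otimes>\<^bsub>H\<^esub> h w"
      using w l' by simp
    have "h [l] \<in> K"
    proof (cases "snd l")
      case True
      then have "[l] = free_gen (fst l)" by (simp add: free_gen_def prod_eq_iff)
      then show ?thesis using gen l by simp
    next
      case False
      then have "[l] \<otimes>\<^bsub>free_group X\<^esub> free_gen (fst l) = \<one>\<^bsub>free_group X\<^esub>"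
        by (simp add: mult_free_group one_free_group free_gen_def reduced_Cons inv_letter_def prod_eq_iff)
      then have "[l] = inv\<^bsub>free_group X\<^esub> (free_gen (fst l))"
        using G.inv_equality l' l by (simp add: free_gen_closed)
      then show ?thesis
        using gen l subgroup.m_inv_closed[OF K] by (simp add: free_gen_closed)
    qed
    then show ?case
      using split Cons.IH w subgroup.m_closed[OF K] by simp
  qed
qed

text \<open>Von Dyck's theorem: the kernel of \<open>h\<close> is normal and contains every relator,
  hence also their normal closure. The coset projection is passed on as an abstract map
  \<open>\<pi>\<close>, so that later steps need no cosets.\<close>

lemma presented_group_hom:
  assumes "group H" and h: "h \<in> hom (free_group X) H"
    and R: "\<And>l r. (l, r) \<in> R \<Longrightarrow>
      l \<in> carrier (free_group X) \<and> r \<in> carrier (free_group X) \<and> h l = h r"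
  obtains g \<pi> where "g \<in> hom (presented_group X R) H"
    "\<pi> \<in> carrier (free_group X) \<rightarrow> carrier (presented_group X R)"
    "\<And>w. w \<in> carrier (free_group X) \<Longrightarrow> g (\<pi> w) = h w"
proof -
  interpret group_hom "free_group X" H h
    by (intro group_hom.intro group_hom_axioms.intro group_free_group assms)
  let ?S = "(\<lambda>(l, r). l \<otimes>\<^bsub>free_group X\<^esub> inv\<^bsub>free_group X\<^esub> r) ` R"
  let ?N = "normal_closure (free_group X) ?S"
  have "?S \<subseteq> kernel (free_group X) H h"
    using R by (fastforce simp: kernel_def)
  then have "?N \<subseteq> kernel (free_group X) H h"
    unfolding normal_closure_def using normal_kernel by blast
  then obtain g where "g \<in> hom (presented_group X R) H"
    "\<And>w. w \<in> carrier (free_group X) \<Longrightarrow> g (r_coset (free_group X) ?N w) = h w"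
    using FactGroup_universal_kernel[OF normal_normal_closure[OF group_free_group, of X ?S]]
    unfolding presented_group_def by blast
  moreover have "r_coset (free_group X) ?N \<in> carrier (free_group X) \<rightarrow> carrier (presented_group X R)"
    by (auto simp: presented_group_def carrier_FactGroup)
  ultimately show thesis using that by blast
qed

lemma (in group) conj_pow_closed [simp]:
  "g \<in> carrier G \<Longrightarrow> h \<in> carrier G \<Longrightarrow> conj_pow G g k h \<in> carrier G"
  by (simp add: conj_pow_def)

lemma (in group_hom) hom_conj_pow:
  assumes "x \<in> carrier G" "y \<in> carrier G"
  shows "h (conj_pow G x k y) = conj_pow H (h x) k (h y)"
  using assms by (simp add: conj_pow_def hom_int_pow)

text \<open>Both sides of each relation are words in the group operations, which \<open>h\<close>
  preserves; checking the relations for \<open>h\<close> becomes a computation in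
  \<open>H\<close>.\<close>

lemma (in group_hom) kishino_relations_hom:
  assumes "a \<in> carrier G" "b \<in> carrier G" "c \<in> carrier G" "d \<in> carrier G"
    and lr: "(l, r) \<in> kishino_relations G a b c d"
  shows "l \<in> carrier G \<and> r \<in> carrier G
    \<and> (h l, h r) \<in> kishino_relations H (h a) (h b) (h c) (h d)"
  using assms unfolding kishino_relations_def by (auto simp: hom_conj_pow)

lemma (in group) conj_pow_small:
  assumes "g \<in> carrier G" "h \<in> carrier G"
  shows "conj_pow G g 1 h = inv h \<otimes> g \<otimes> h"
    "conj_pow G g 2 h = inv h \<otimes> (g \<otimes> g) \<otimes> h"
    "conj_pow G g (- 1) h = inv h \<otimes> inv g \<otimes> h"
    "conj_pow G g (- 2) h = inv h \<otimes> inv (g \<otimes> g) \<otimes> h"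
proof -
  have "g [^] (2::int) = g \<otimes> g"
    using assms int_pow_mult[of g 1 1] by simp
  then show "conj_pow G g 1 h = inv h \<otimes> g \<otimes> h"
    "conj_pow G g 2 h = inv h \<otimes> (g \<otimes> g) \<otimes> h"
    "conj_pow G g (- 1) h = inv h \<otimes> inv g \<otimes> h"
    "conj_pow G g (- 2) h = inv h \<otimes> inv (g \<otimes> g) \<otimes> h"
    using assms by (simp_all add: conj_pow_def int_pow_neg)
qed

text \<open>The scalars agree because 2 has order 4 modulo 5: weighting a, b, c by 1 and d by 0, the
  two sides have exponent sums -7 and -3, 1 and 1, 1 and -3. The translation parts are then compared
  pointwise, for arbitrary \<open>p\<close>, \<open>q\<close>, \<open>r\<close>.\<close>

lemma kishino_relations_affine_group:
  fixes p q r :: "'v \<Rightarrow> 5"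
  assumes "(x, y) \<in> kishino_relations affine_group (2, p) (2, q) (2, r) (1, \<lambda>v. r v - p v)"
  shows "x = y"
proof -
  interpret group "affine_group :: (5 \<times> ('v \<Rightarrow> 5)) monoid"
    by (rule group_affine_group)
  have units: "(2::5) dvd 1" "(3::5) dvd 1" "(4::5) dvd 1"
    by (rule dvdI[of _ _ 3], simp, rule dvdI[of _ _ 2], simp, rule dvdI[of _ _ 4], simp)
  have inv2: "inv\<^bsub>affine_group\<^esub> (2, f) = (3, \<lambda>v. - 3 * f v)" for f :: "'v \<Rightarrow> 5"
    by (subst inv_affine_group[of _ 3]) simp_all
  \<comment> \<open>The scalar 4 = 2 * 2 comes from the squares that the exponents -2
    invert.\<close>
  have inv4: "inv\<^bsub>affine_group\<^esub> (4, f) = (4, \<lambda>v. - 4 * f v)" for f :: "'v \<Rightarrow> 5"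
    by (subst inv_affine_group[of _ 4]) simp_all
  have inv1: "inv\<^bsub>affine_group\<^esub> (1, f) = (1, \<lambda>v. - f v)" for f :: "'v \<Rightarrow> 5"
    by (subst inv_affine_group[of _ 1]) simp_all
  \<comment> \<open>The coefficients left over when the relations are expanded; the simplifier decides them only in isolation.\<close>
  have multiples: "(1585::5) = 0" "(30::5) = 0" "(5290::5) = 0" "(5::5) = 0"
    "(27125::5) = 0" "(31065::5) = 0" "(31120::5) = 0"
    by simp_all
  show ?thesis
    using assms unfolding kishino_relations_def
    by (auto simp: conj_pow_small units inv1 inv2 inv4 fun_eq_iff algebra_simps) (simp_all add: multiples)
qed

theorem theorem5p1:
  shows "\<not> (kishino_group \<cong> free_group {0::nat, 1})"
proof
  let ?H = "affine_group :: (5 \<times> (5 \<times> 5 \<times> 5 \<Rightarrow> 5)) monoid"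
  let ?F = "free_group (UNIV :: kishino_gen set)"
  let ?R = "kishino_relations ?F (free_gen Gen_a) (free_gen Gen_b) (free_gen Gen_c) (free_gen Gen_d)"
  \<comment> \<open>The three coordinate functions of \<open>v\<close> make the values at a, b and c
    independent; the value at d is forced by the relations.\<close>
  define e :: "kishino_gen \<Rightarrow> 5 \<times> (5 \<times> 5 \<times> 5 \<Rightarrow> 5)" where
    "e x = (case x of Gen_a \<Rightarrow> (2, fst) | Gen_b \<Rightarrow> (2, \<lambda>v. fst (snd v))
      | Gen_c \<Rightarrow> (2, \<lambda>v. snd (snd v)) | Gen_d \<Rightarrow> (1, \<lambda>v. snd (snd v) - fst v))" for x
  have "(2::5) dvd 1" by (rule dvdI[of _ _ 3]) simp
  then have "e x \<in> carrier ?H" for x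
    by (cases x) (simp_all add: e_def)
  then obtain h where h: "h \<in> hom ?F ?H" and h_gen: "\<And>x. h (free_gen x) = e x"
    using free_group_universal[OF group_affine_group, of UNIV e] by auto
  interpret h: group_hom ?F ?H h
    by (intro group_hom.intro group_hom_axioms.intro group_free_group group_affine_group h)
  have "l \<in> carrier ?F \<and> r \<in> carrier ?F \<and> h l = h r" if "(l, r) \<in> ?R" for l r
    using h.kishino_relations_hom[OF _ _ _ _ that] kishino_relations_affine_group[of "h l" "h r"]
    by (auto simp: free_gen_closed h_gen e_def)
  then obtain g \<pi> where g: "g \<in> hom kishino_group ?H"
    and \<pi>: "\<pi> \<in> carrier ?F \<rightarrow> carrier kishino_group"
    and g\<pi>: "\<And>w. w \<in> carrier ?F \<Longrightarrow> g (\<pi> w) = h w"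
    using presented_group_hom[OF group_affine_group h, of ?R] unfolding kishino_group_def by blast
  assume "kishino_group \<cong> free_group {0::nat, 1}"
  then obtain \<psi> where \<psi>: "\<psi> \<in> iso (free_group {0::nat, 1}) kishino_group"
    using group.iso_sym[OF group_kishino_group] unfolding is_iso_def by blast
  then have k: "g \<circ> \<psi> \<in> hom (free_group {0, 1}) ?H"
    using g by (auto simp: iso_def intro: hom_compose)
  let ?t = "\<lambda>i. snd (g (\<psi> (free_gen i)))"
  \<comment> \<open>Pigeonhole: there are 125 parameters but only 25 pairs of values at the two free
    generators.\<close>
  have "\<not> inj (\<lambda>v. (?t 0 v, ?t 1 v))"
  proof
    assume "inj (\<lambda>v. (?t 0 v, ?t 1 v))"
    from card_inj_on_le[OF this, of UNIV] show False by simp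
  qed
  then obtain v v' where "v \<noteq> v'" and eq: "?t 0 v = ?t 0 v'" "?t 1 v = ?t 1 v'"
    unfolding inj_def by blast
  let ?K = "{x \<in> carrier ?H. snd x v = snd x v'}"
  \<comment> \<open>Surjectivity of \<open>\<psi>\<close> spreads the agreement at \<open>v\<close>
    and \<open>v'\<close> from the two free generators to the whole group.\<close>
  have "g z \<in> ?K" if "z \<in> carrier kishino_group" for z
  proof -
    obtain w where w: "w \<in> carrier (free_group {0, 1})" "z = \<psi> w"
      using \<psi> \<open>z \<in> _\<close> by (auto simp: iso_def bij_betw_def)
    have "(g \<circ> \<psi>) (free_gen i) \<in> ?K" if "i \<in> {0, 1}" for i
      using that eq hom_in_carrier[OF k free_gen_closed[OF that]] by auto
    from hom_free_group_in_subgroup[OF group_affine_group k subgroup_affine_group_eq this w(1)]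
    show ?thesis using w by simp
  qed
  \<comment> \<open>Applied to the classes of a, b and c, this agreement equates all three
    coordinates of \<open>v\<close> and \<open>v'\<close>.\<close>
  then have "snd (e x) v = snd (e x) v'" for x
    using g\<pi>[of "free_gen x"] \<pi> free_gen_closed[of x UNIV] h_gen[of x] by fastforce
  from this[of Gen_a] this[of Gen_b] this[of Gen_c] show False
    using \<open>v \<noteq> v'\<close> by (simp add: e_def prod_eq_iff)
qed

end
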